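(* For all positive integers $H$ and $t$, for all but finitely many positive integers $n$, we have $\mathrm{rk}^{(H)}(t\text{-}\mathsf{Comp}_n)=t$.
   Context: **Iterated composition.** For positive integers $t,n$ and $[n]=\{1,\ldots,n\}$, the function $t\text{-}\mathsf{Comp}_n\colon[n]^n\to[n]$ takes a word $(\phi(1),\ldots,\phi(n))$, interpreted as a function $\phi\colon[n]\to[n]$, to $\phi(\phi(\cdots\phi(1)\cdots))$, where $\phi$ is applied $t$ times. **$H$-head rank.** Let $f\colon\Sigma_1\times\cdots\times\Sigma_n\to O$ with all sets finite. An assignment is a pair $(i,\sigma)$ with $i\in[n]$, $\sigma\in\Sigma_i$; $A$ is the set of all assignments. The assignment $(i,\sigma)$ is consistent with $\bar w=(\sigma_1,\ldots,\sigma_n)$ iff $\sigma_i=\sigma$. For a bijection $\tau\colon\{1,\ldots,|A|\}\to A$ (a permutation of $A$), the a-query $q_\tau\colon\Sigma_1\times\cdots\times\Sigma_n\to A$ is defined by $q_\tau(\bar w)=\tau(k)$ for the minimal $k$ such that $\tau(k)$ is consistent with $\bar w$. An $H$-degree a-query is a product $\bar w\mapsto(q_{\tau_1}(\bar w),\ldots,q_{\tau_H}(\bar w))$ of $H$ a-queries. A decision tree over a family of queries is a rooted tree in which each non-leaf node $v$ is labeled by a query $q_v$ from the family and has exactly $|\mathrm{Im}(q_v)|$ outgoing edges, labeled by the distinct elements of $\mathrm{Im}(q_v)$, and each leaf is labeled by an element of $O$; on input $\bar w$ one descends from the root, at each $v$ following the edge labeled $q_v(\bar w)$, and outputs the label of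 the leaf reached. The tree computes $f$ if it outputs $f(\bar w)$ on every input $\bar w$. The depth is the maximal number of edges on a root-to-leaf path. $\mathrm{rk}^{(H)}(f)$ is the minimal depth of a decision tree over $H$-degree a-queries computing $f$. *)

theory Defs
  imports Main "HOL-Library.FuncSet" "HOL-Library.Finite_Map"
begin

text \<open>
  Words \<open>(\<sigma>\<^sub>1, \<dots>, \<sigma>\<^sub>n) \<in> \<Sigma>\<^sub>1 \<times> \<dots> \<times> \<Sigma>\<^sub>n\<close> are the extensional functions in
  \<open>PiE {1..n} \<Sigma>\<close>; the letters at all positions live in a common type.
\<close>

definition words :: "nat \<Rightarrow> (nat \<Rightarrow> 'a set) \<Rightarrow> (nat \<Rightarrow> 'a) set" where
  "words n \<Sigma> = PiE {1..n} \<Sigma>"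

definition assignments :: "nat \<Rightarrow> (nat \<Rightarrow> 'a set) \<Rightarrow> (nat \<times> 'a) set" where
  "assignments n \<Sigma> = Sigma {1..n} \<Sigma>"

definition consistent :: "nat \<times> 'a \<Rightarrow> (nat \<Rightarrow> 'a) \<Rightarrow> bool" where
  "consistent a w \<longleftrightarrow> w (fst a) = snd a"

definition assignment_perms :: "nat \<Rightarrow> (nat \<Rightarrow> 'a set) \<Rightarrow> (nat \<Rightarrow> nat \<times> 'a) set" where
  "assignment_perms n \<Sigma> =
     {\<tau>. bij_betw \<tau> {1..card (assignments n \<Sigma>)} (assignments n \<Sigma>)}"

definition a_query ::
  "nat \<Rightarrow> (nat \<Rightarrow> 'a set) \<Rightarrow> (nat \<Rightarrow> nat \<times> 'a) \<Rightarrow> (nat \<Rightarrow> 'a) \<Rightarrow> nat \<times> 'a" where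
  "a_query n \<Sigma> \<tau> w =
     \<tau> (LEAST k. k \<in> {1..card (assignments n \<Sigma>)} \<and> consistent (\<tau> k) w)"

text \<open>The value of a product of \<open>H\<close> a-queries is the list of the \<open>H\<close> individual answers.\<close>

definition degree_a_queries ::
  "nat \<Rightarrow> nat \<Rightarrow> (nat \<Rightarrow> 'a set) \<Rightarrow> ((nat \<Rightarrow> 'a) \<Rightarrow> (nat \<times> 'a) list) set" where
  "degree_a_queries H n \<Sigma> =
     {\<lambda>w. map (\<lambda>\<tau>. a_query n \<Sigma> \<tau> w) \<tau>s | \<tau>s.
        length \<tau>s = H \<and> set \<tau>s \<subseteq> assignment_perms n \<Sigma>}"

text \<open>
  An inner node carries its query and a finite map sending each edge label to the subtree
  below that edge.
\<close>

datatype ('x, 'r, 'o) dtree =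
    Leaf 'o
  | Node "'x \<Rightarrow> 'r" "('r, ('x, 'r, 'o) dtree) fmap"

text \<open>
  \<open>X\<close> is the set of inputs, \<open>Q\<close> the family of queries, \<open>Out\<close> the set of outputs. Queries
  are total functions on the input type, but only their values on \<open>X\<close> matter.
\<close>

inductive decision_tree ::
  "'x set \<Rightarrow> ('x \<Rightarrow> 'r) set \<Rightarrow> 'o set \<Rightarrow> ('x, 'r, 'o) dtree \<Rightarrow> bool"
  for X Q Out where
  Leaf: "y \<in> Out \<Longrightarrow> decision_tree X Q Out (Leaf y)"
| Node: "q \<in> Q \<Longrightarrow> fmdom' m = q ` X \<Longrightarrow>
    (\<And>r T. fmlookup m r = Some T \<Longrightarrow> decision_tree X Q Out T) \<Longrightarrow>
    decision_tree X Q Out (Node q m)"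

primrec dtree_output :: "('x, 'r, 'o) dtree \<Rightarrow> 'x \<Rightarrow> 'o" where
  "dtree_output (Leaf y) = (\<lambda>x. y)"
| "dtree_output (Node q m) = (\<lambda>x. the (fmlookup (fmmap dtree_output m) (q x)) x)"

text \<open>
  In a tree satisfying \<open>decision_tree X Q Out\<close> with \<open>X \<noteq> {}\<close>, every inner node has at least
  one outgoing edge, so the maximum is taken over a nonempty finite set.
\<close>

primrec dtree_depth :: "('x, 'r, 'o) dtree \<Rightarrow> nat" where
  "dtree_depth (Leaf y) = 0"
| "dtree_depth (Node q m) = Suc (Max (fmran' (fmmap dtree_depth m)))"

definition computes :: "'x set \<Rightarrow> ('x, 'r, 'o) dtree \<Rightarrow> ('x \<Rightarrow> 'o) \<Rightarrow> bool" where
  "computes X T f \<longleftrightarrow> (\<forall>x\<in>X. dtree_output T x = f x)"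

definition head_rank ::
  "nat \<Rightarrow> nat \<Rightarrow> (nat \<Rightarrow> 'a set) \<Rightarrow> 'o set \<Rightarrow> ((nat \<Rightarrow> 'a) \<Rightarrow> 'o) \<Rightarrow> nat" where
  "head_rank H n \<Sigma> Out f =
     (LEAST d. \<exists>T. decision_tree (words n \<Sigma>) (degree_a_queries H n \<Sigma>) Out T \<and>
                   computes (words n \<Sigma>) T f \<and> dtree_depth T = d)"

definition iter_comp :: "nat \<Rightarrow> nat \<Rightarrow> (nat \<Rightarrow> nat) \<Rightarrow> nat" where
  "iter_comp t n = (\<lambda>\<phi>\<in>words n (\<lambda>_. {1..n}). (\<phi> ^^ t) 1)"

end

theory Submission
  imports Defs
begin

text \<open>
  Lower bound: an adversary keeps a box \<open>S 1 \<times> \<dots> \<times> S n\<close> of inputs on which all answers so far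
  are constant, such that after \<open>r\<close> queries the value \<open>v = \<phi>\<^sup>r(1)\<close> is the same on the whole box
  and \<open>S i\<close> is large outside a small set of coordinates that does not contain \<open>v\<close>. To answer an
  a-query, the adversary walks along its permutation and deletes assignments \<open>(i, \<sigma>)\<close>, \<open>i \<noteq> v\<close>,
  from the box until some \<open>S i\<close> would lose half of its elements. If at least half of the letters
  of \<open>S v\<close> were met before, it retains only these, so that the answer becomes a function of
  \<open>\<phi>(v)\<close>; otherwise it retains the other letters of \<open>S v\<close>, and the answer is the assignment at
  which the walk stopped, at the cost of fixing its coordinate. After the \<open>H\<close> heads have been
  served, \<open>S v\<close> still contains a letter outside the set of small coordinates, and \<open>\<phi>(v)\<close> is set
  to it.
\<close>

lemma a_query_eqI:
  assumes "k \<in> {1..card (assignments n \<Sigma>)}" "consistent (\<tau> k) w"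
    and "\<And>l. 1 \<le> l \<Longrightarrow> l < k \<Longrightarrow> \<not> consistent (\<tau> l) w"
  shows "a_query n \<Sigma> \<tau> w = \<tau> k"
proof -
  have "(LEAST k. k \<in> {1..card (assignments n \<Sigma>)} \<and> consistent (\<tau> k) w) = k"
    using assms by (intro Least_equality) (auto simp: not_less[symmetric])
  thus ?thesis by (simp add: a_query_def)
qed

lemma finite_assignments:
  "(\<And>i. i \<in> {1..n} \<Longrightarrow> finite (\<Sigma> i)) \<Longrightarrow> finite (assignments n \<Sigma>)"
  by (auto simp: assignments_def)


section \<open>Upper bound\<close>

text \<open>Any permutation that lists all assignments of position \<open>v\<close> first will do:
  exactly one of them is consistent with a given word, and it is met before any assignment of
  another position.\<close>

lemma ex_a_query_reading_position:
  assumes fin: "\<And>i. i \<in> {1..n} \<Longrightarrow> finite (\<Sigma> i)" and v: "v \<in> {1..n}"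
  obtains \<tau> where "\<tau> \<in> assignment_perms n \<Sigma>"
    and "\<And>w. w \<in> words n \<Sigma> \<Longrightarrow> a_query n \<Sigma> \<tau> w = (v, w v)"
proof -
  define A where "A = assignments n \<Sigma>"
  define B where "B = {v} \<times> \<Sigma> v"
  have finA: "finite A" using fin by (auto simp: A_def intro: finite_assignments)
  have BA: "B \<subseteq> A" using v by (auto simp: A_def B_def assignments_def)
  have finB: "finite B" using finA BA finite_subset by blast
  have cBA: "card B \<le> card A" using BA finA card_mono by blast
  obtain f where f: "bij_betw f {1..card B} B"
    using finite_same_card_bij[of "{1..card B}" B] finB by auto
  obtain g where g: "bij_betw g {Suc (card B)..card A} (A - B)"
    using finite_same_card_bij[of "{Suc (card B)..card A}" "A - B"] finA finB BA
    by (auto simp: card_Diff_subset)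
  define \<tau> where "\<tau> = (\<lambda>k. if k \<le> card B then f k else g k)"
  have 1: "bij_betw \<tau> {1..card B} B"
    using f by (subst bij_betw_cong[where g = f]) (auto simp: \<tau>_def)
  have 2: "bij_betw \<tau> {Suc (card B)..card A} (A - B)"
    using g by (subst bij_betw_cong[where g = g]) (auto simp: \<tau>_def)
  have "bij_betw \<tau> ({1..card B} \<union> {Suc (card B)..card A}) (B \<union> (A - B))"
    by (rule bij_betw_combine[OF 1 2]) auto
  moreover have "{1..card B} \<union> {Suc (card B)..card A} = {1..card A}" using cBA by auto
  moreover have "B \<union> (A - B) = A" using BA by auto
  ultimately have \<tau>: "\<tau> \<in> assignment_perms n \<Sigma>" by (simp add: assignment_perms_def A_def)
  have "a_query n \<Sigma> \<tau> w = (v, w v)" if w: "w \<in> words n \<Sigma>" for w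
  proof -
    have "(v, w v) \<in> B" using w v by (auto simp: words_def B_def)
    then obtain k where k: "k \<in> {1..card B}" "\<tau> k = (v, w v)"
      using 1 by (metis bij_betw_imp_surj_on imageE)
    have "a_query n \<Sigma> \<tau> w = \<tau> k"
    proof (rule a_query_eqI)
      show "k \<in> {1..card (assignments n \<Sigma>)}" using k(1) cBA by (auto simp: A_def)
      show "consistent (\<tau> k) w" using k(2) by (simp add: consistent_def)
      fix l assume l: "1 \<le> l" "l < k"
      hence "\<tau> l \<in> B" using 1 k(1) by (auto simp: bij_betw_def)
      moreover have "\<tau> l \<noteq> \<tau> k"
        using 1 k(1) l by (auto simp: bij_betw_def dest: inj_onD)
      ultimately show "\<not> consistent (\<tau> l) w"
        using k(2) by (auto simp: B_def consistent_def)
    qed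
    thus ?thesis using k(2) by simp
  qed
  with \<tau> show ?thesis by (rule that)
qed

lemma ex_fmlookup_eq:
  assumes "finite (dom f)"
  obtains m where "fmlookup m = f"
  using assms fmlookup_cases by blast

text \<open>Each level reads one position: the root reveals \<open>w v\<close>, and below that edge
  hangs the tree that continues from \<open>w v\<close>. The start \<open>v\<close> is therefore
  arbitrary in the induction. All subtrees have the same depth, so the maximum over the edges is
  exact as well.\<close>

lemma ex_tree_iterating:
  assumes H: "H > 0" and v: "v \<in> {1..n}"
  defines "\<Sigma> \<equiv> \<lambda>_::nat. {1..n}"
  shows "\<exists>T. decision_tree (words n \<Sigma>) (degree_a_queries H n \<Sigma>) {1..n} T \<and>
     dtree_depth T = d \<and> (\<forall>w\<in>words n \<Sigma>. dtree_output T w = (w ^^ d) v)"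
  using v
proof (induction d arbitrary: v)
  case 0
  thus ?case by (intro exI[of _ "Leaf v"]) (auto intro: decision_tree.Leaf)
next
  case (Suc d)
  let ?X = "words n \<Sigma>" and ?Q = "degree_a_queries H n \<Sigma>"
  obtain \<tau> where \<tau>: "\<tau> \<in> assignment_perms n \<Sigma>"
      "\<And>w. w \<in> ?X \<Longrightarrow> a_query n \<Sigma> \<tau> w = (v, w v)"
    using ex_a_query_reading_position[of n \<Sigma> v] Suc.prems by (auto simp: \<Sigma>_def)
  \<comment> \<open>All \<open>H\<close> heads repeat the same a-query; by \<open>H > 0\<close> its
    answer can be recovered with \<open>hd\<close>.\<close>
  define q where "q = (\<lambda>w. map (\<lambda>\<tau>. a_query n \<Sigma> \<tau> w) (replicate H \<tau>))"
  have q: "q w = replicate H (v, w v)" if "w \<in> ?X" for w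
    using \<tau>(2)[OF that] by (simp add: q_def map_replicate_const)
  have qQ: "q \<in> ?Q"
    unfolding degree_a_queries_def q_def using \<tau>(1) by (auto intro!: exI[of _ "replicate H \<tau>"])
  have "\<forall>u\<in>{1..n}. \<exists>T. decision_tree ?X ?Q {1..n} T \<and>
      dtree_depth T = d \<and> (\<forall>w\<in>?X. dtree_output T w = (w ^^ d) u)"
    using Suc.IH by blast
  then obtain T where T: "\<And>u. u \<in> {1..n} \<Longrightarrow> decision_tree ?X ?Q {1..n} (T u)"
      "\<And>u. u \<in> {1..n} \<Longrightarrow> dtree_depth (T u) = d"
      "\<And>u w. u \<in> {1..n} \<Longrightarrow> w \<in> ?X \<Longrightarrow> dtree_output (T u) w = (w ^^ d) u"
    by metis
  have X_val: "w v \<in> {1..n}" if "w \<in> ?X" for w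
    using that Suc.prems by (auto simp: words_def \<Sigma>_def)
  have "q ` ?X \<subseteq> (\<lambda>u. replicate H (v, u)) ` {1..n}" using q X_val by auto
  hence "finite (q ` ?X)" by (rule finite_subset) simp
  moreover define f where "f = (\<lambda>r. if r \<in> q ` ?X then Some (T (snd (hd r))) else None)"
  ultimately have "finite (dom f)" by (auto simp: dom_def)
  then obtain m where m: "fmlookup m = f" by (rule ex_fmlookup_eq)
  have fq: "f (q w) = Some (T (w v))" if "w \<in> ?X" for w
    using imageI[OF that, of q] q[OF that] H by (simp add: f_def hd_replicate)
  have f_Some: "\<exists>w\<in>?X. U = T (w v)" if "f r = Some U" for r U
    using that fq by (auto simp: f_def split: if_splits)
  have dom: "fmdom' m = q ` ?X"
    by (auto simp: fmdom'_alt_def fmlookup_dom_iff fmdom'.rep_eq m f_def dom_def split: if_splits)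
  have tree: "decision_tree ?X ?Q {1..n} (Node q m)"
    using qQ dom by (rule decision_tree.Node) (use m f_Some T(1) X_val in force)
  have ran: "fmran' (fmmap dtree_depth m) = {d}"
  proof -
    \<comment> \<open>A word must exist, so that the root has an edge and \<open>Max\<close> is
      taken over a nonempty set.\<close>
    have "(\<lambda>_\<in>{1..n}. v) \<in> ?X" using Suc.prems by (auto simp: words_def \<Sigma>_def)
    hence "\<exists>U. U \<in> fmran' m" using fq by (metis fmlookup_ran'_iff m)
    moreover have "dtree_depth U = d" if "U \<in> fmran' m" for U
      using that f_Some T(2) X_val by (metis fmlookup_ran'_iff m)
    ultimately show ?thesis by (auto simp: image_iff)
  qed
  have "dtree_output (Node q m) w = (w ^^ Suc d) v" if "w \<in> ?X" for w
    using fq[OF that] T(3)[OF X_val[OF that] that] by (simp add: m funpow_swap1)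
  thus ?case using tree ran by (intro exI[of _ "Node q m"]) auto
qed


section \<open>Lower bound\<close>

text \<open>The walk stops at the first moment when half of some \<open>S i\<close> with
  \<open>i \<noteq> v\<close> is met, so deleting what was met before costs each such position less
  than half. The coordinate given up must not be \<open>v\<close>, because \<open>w v\<close> is
  still to be chosen and the answer may depend on it.\<close>

lemma a_query_restrict:
  fixes S :: "nat \<Rightarrow> 'a set"
  assumes fin: "\<And>i. i \<in> {1..n} \<Longrightarrow> finite (\<Sigma> i)"
    and \<tau>: "\<tau> \<in> assignment_perms n \<Sigma>"
    and S: "\<And>i. i \<in> {1..n} \<Longrightarrow> S i \<subseteq> \<Sigma> i" "\<And>i. i \<in> {1..n} \<Longrightarrow> S i \<noteq> {}"
    and v: "v \<in> {1..n}" and n: "n \<ge> 2"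
  obtains S' j where "\<And>i. i \<in> {1..n} \<Longrightarrow> S' i \<subseteq> S i" "\<And>i. i \<in> {1..n} \<Longrightarrow> S' i \<noteq> {}"
    "j \<noteq> v" "\<And>i. i \<in> {1..n} \<Longrightarrow> i \<noteq> j \<Longrightarrow> card (S i) \<le> 2 * card (S' i)"
    "\<And>w w'. w \<in> words n S' \<Longrightarrow> w' \<in> words n S' \<Longrightarrow> w v = w' v \<Longrightarrow>
       a_query n \<Sigma> \<tau> w = a_query n \<Sigma> \<tau> w'"
proof -
  define N where "N = card (assignments n \<Sigma>)"
  define seen where "seen = (\<lambda>k i. {\<sigma> \<in> S i. (i, \<sigma>) \<in> \<tau> ` {1..k}})"
  \<comment> \<open>Stopping condition of the walk. Position \<open>v\<close> is exempt: any number
    of its letters may be met.\<close>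
  define P where "P = (\<lambda>k. k \<le> N \<and> (\<exists>i\<in>{1..n}-{v}. card (S i) \<le> 2 * card (seen k i)))"
  have bij: "inj_on \<tau> {1..N}" "\<tau> ` {1..N} = assignments n \<Sigma>"
    using \<tau> by (auto simp: assignment_perms_def N_def bij_betw_def)
  have finS: "finite (S i)" if "i \<in> {1..n}" for i
    using finite_subset[OF S(1) fin] that by blast
  have cardS: "card (S i) > 0" if "i \<in> {1..n}" for i
    using finS[OF that] S(2)[OF that] by (simp add: card_gt_0_iff)
  have fin_seen: "finite (seen k i)" if "i \<in> {1..n}" for k i
    using finS[OF that] by (simp add: seen_def)
  \<comment> \<open>By \<open>n \<ge> 2\<close> there is a position other than \<open>v\<close>; all
    its letters are met by the end of the permutation, so the walk does stop.\<close>
  have "\<exists>i. i \<in> {1..n} - {v}" by (rule exI[of _ "if v = 1 then 2 else 1"]) (use n in auto)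
  then obtain i0 where i0: "i0 \<in> {1..n} - {v}" by blast
  have "seen N i0 = S i0" unfolding seen_def bij(2) using i0 S(1)[of i0] by (auto simp: assignments_def)
  hence "card (S i0) \<le> 2 * card (seen N i0)" by simp
  hence "P N" using i0 unfolding P_def by blast
  define k where "k = (LEAST k. P k)"
  have "P k" unfolding k_def using \<open>P N\<close> by (rule LeastI)
  then obtain j where j: "j \<in> {1..n} - {v}" "card (S j) \<le> 2 * card (seen k j)" and kN: "k \<le> N"
    unfolding P_def by blast
  have "k \<noteq> 0"
  proof
    assume "k = 0"
    hence "seen k j = {}" by (simp add: seen_def)
    thus False using j cardS[of j] by simp
  qed
  then obtain k' where k': "k = Suc k'" by (cases k) auto
  have "\<not> P k'" using not_less_Least[of k' P] by (simp add: k_def[symmetric] k')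
  hence half: "2 * card (seen k' i) < card (S i)" if "i \<in> {1..n}" "i \<noteq> v" for i
    using that kN k' by (auto simp: P_def not_le[symmetric])
  \<comment> \<open>The count at \<open>j\<close> reaches half exactly at entry \<open>k\<close>, so
    this entry is an assignment of \<open>j\<close> with a letter of \<open>S j\<close> not met
    before.\<close>
  have "\<not> seen k j \<subseteq> seen k' j"
    using card_mono[of "seen k' j" "seen k j"] half[of j] j fin_seen[of j k'] by auto
  then obtain \<rho> where \<rho>: "\<rho> \<in> S j" "(j, \<rho>) \<in> \<tau> ` {1..k}" "(j, \<rho>) \<notin> \<tau> ` {1..k'}"
    by (auto simp: seen_def)
  have \<tau>k: "\<tau> k = (j, \<rho>)"
    using \<rho>(2,3) by (auto simp: k' atLeastAtMostSuc_conv)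
  \<comment> \<open>No entry before the \<open>k\<close>-th is consistent with a word whose letters
    all lie in \<open>R\<close>.\<close>
  define R where "R = (\<lambda>i. S i - seen k' i)"
  have cardR: "card (R i) = card (S i) - card (seen k' i)" if "i \<in> {1..n}" for i
    unfolding R_def using fin_seen[OF that] by (rule card_Diff_subset) (auto simp: seen_def)
  have R_half: "card (S i) \<le> 2 * card (R i)" if "i \<in> {1..n}" "i \<noteq> v" for i
    using half[OF that] cardR[OF that(1)] by simp
  have unseen: "\<tau> l \<noteq> (i, w i)" if "w i \<in> R i" "l \<in> {1..k'}" for w i l
    using that by (auto simp: R_def seen_def) (metis atLeastAtMost_iff image_eqI)
  have fst_\<tau>: "fst (\<tau> l) \<in> {1..n}" if "l \<in> {1..N}" for l
    using imageI[OF that, of \<tau>] unfolding bij(2) by (auto simp: assignments_def)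
  have ne: "A \<noteq> {}" if "i \<in> {1..n}" "card (S i) \<le> 2 * card A" for A :: "'a set" and i
    using cardS[OF that(1)] that(2) by auto
  show ?thesis
  proof (cases "card (S v) \<le> 2 * card (seen k' v)")
    case True
    define S' where "S' = R(v := seen k' v)"
    \<comment> \<open>Every coordinate keeps at least half here: \<open>v\<close> by the case
      assumption, the others, \<open>j\<close> included, by \<open>R_half\<close>.\<close>
    have big: "card (S i) \<le> 2 * card (S' i)" if "i \<in> {1..n}" for i
      using R_half[OF that] True by (auto simp: S'_def)
    \<comment> \<open>Among the first \<open>k'\<close> entries only \<open>(v, w v)\<close> can be
      consistent with \<open>w\<close>, and it does occur because \<open>w v\<close> was
      met.\<close>
    have ans: "a_query n \<Sigma> \<tau> w = (v, w v)" if w: "w \<in> words n S'" for w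
    proof -
      have "w v \<in> seen k' v" using w v by (auto simp: words_def S'_def dest: PiE_mem)
      then obtain l where l: "l \<in> {1..k'}" "\<tau> l = (v, w v)" by (auto simp: seen_def)
      have "a_query n \<Sigma> \<tau> w = \<tau> l"
      proof (rule a_query_eqI)
        show "l \<in> {1..card (assignments n \<Sigma>)}" using l(1) kN k' by (auto simp: N_def)
        show "consistent (\<tau> l) w" using l(2) by (simp add: consistent_def)
        fix l' assume l': "1 \<le> l'" "l' < l"
        show "\<not> consistent (\<tau> l') w"
        proof
          assume "consistent (\<tau> l') w"
          hence eq: "\<tau> l' = (fst (\<tau> l'), w (fst (\<tau> l')))"
            by (simp add: consistent_def prod_eq_iff)
          have "fst (\<tau> l') \<noteq> v"
          proof
            assume "fst (\<tau> l') = v"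
            hence "\<tau> l' = \<tau> l" using eq l(2) by simp
            thus False using inj_onD[OF bij(1), of l' l] l' l(1) kN k' by auto
          qed
          moreover have "fst (\<tau> l') \<in> {1..n}" using l' l(1) kN k' by (intro fst_\<tau>) auto
          ultimately have "w (fst (\<tau> l')) \<in> R (fst (\<tau> l'))"
            using PiE_mem[OF w[unfolded words_def], of "fst (\<tau> l')"] by (simp add: S'_def)
          thus False using unseen eq l' l(1) by (meson atLeastAtMost_iff le_trans less_imp_le)
        qed
      qed
      thus ?thesis using l(2) by simp
    qed
    show ?thesis
    proof (rule that[of S' j])
      show "S' i \<subseteq> S i" for i by (auto simp: S'_def R_def seen_def)
      show "S' i \<noteq> {}" if "i \<in> {1..n}" for i using ne[OF that big[OF that]] .
    qed (use j(1) big ans in auto)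
  next
    case False
    define S' where "S' = R(j := {\<rho>})"
    \<comment> \<open>Fewer than half of the letters of \<open>S v\<close> were met, so the unmet
      ones are more than half; only \<open>j\<close> becomes a singleton.\<close>
    have big: "card (S i) \<le> 2 * card (S' i)" if "i \<in> {1..n}" "i \<noteq> j" for i
      using R_half[OF that(1)] False cardR[OF v] that(2) by (cases "i = v") (auto simp: S'_def)
    \<comment> \<open>Entry \<open>k\<close> is \<open>(j, \<rho>)\<close>. It does not occur
      earlier, and the letters in earlier entries of the other positions, \<open>v\<close> included,
      were deleted from the box.\<close>
    have ans: "a_query n \<Sigma> \<tau> w = \<tau> k" if w: "w \<in> words n S'" for w
    proof (rule a_query_eqI)
      have wj: "w j = \<rho>" using PiE_mem[OF w[unfolded words_def], of j] j by (simp add: S'_def)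
      show "k \<in> {1..card (assignments n \<Sigma>)}" using kN k' by (auto simp: N_def)
      show "consistent (\<tau> k) w" using \<tau>k wj by (simp add: consistent_def)
      fix l assume l: "1 \<le> l" "l < k"
      show "\<not> consistent (\<tau> l) w"
      proof
        assume "consistent (\<tau> l) w"
        hence eq: "\<tau> l = (fst (\<tau> l), w (fst (\<tau> l)))"
          by (simp add: consistent_def prod_eq_iff)
        have l': "l \<in> {1..k'}" using l k' by simp
        have "fst (\<tau> l) \<noteq> j" using eq wj \<rho>(3) l' by (metis imageI)
        moreover have "fst (\<tau> l) \<in> {1..n}" using l kN by (intro fst_\<tau>) auto
        ultimately have "w (fst (\<tau> l)) \<in> R (fst (\<tau> l))"
          using PiE_mem[OF w[unfolded words_def], of "fst (\<tau> l)"] by (simp add: S'_def)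
        thus False using unseen eq l' by blast
      qed
    qed
    show ?thesis
    proof (rule that[of S' j])
      show "S' i \<subseteq> S i" for i using \<rho>(1) by (auto simp: S'_def R_def)
      show "S' i \<noteq> {}" if "i \<in> {1..n}" for i
        using ne[OF that big[OF that]] by (cases "i = j") (auto simp: S'_def)
    qed (use j(1) big ans in auto)
  qed
qed

section \<open>All heads of one query\<close>

lemma words_mono: "(\<And>i. i \<in> {1..n} \<Longrightarrow> S' i \<subseteq> S i) \<Longrightarrow> words n S' \<subseteq> words n S"
  unfolding words_def by (rule PiE_mono)

text \<open>The heads are served one after another. Shrinking the box further cannot destroy what
  was achieved for an earlier head, so the losses accumulate: one exceptional coordinate per head,
  and a factor of two per head elsewhere.\<close>

lemma a_queries_restrict:
  fixes S :: "nat \<Rightarrow> 'a set"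
  assumes fin: "\<And>i. i \<in> {1..n} \<Longrightarrow> finite (\<Sigma> i)"
    and v: "v \<in> {1..n}" and n: "n \<ge> 2"
    and \<tau>s: "set \<tau>s \<subseteq> assignment_perms n \<Sigma>"
    and S: "\<And>i. i \<in> {1..n} \<Longrightarrow> S i \<subseteq> \<Sigma> i" "\<And>i. i \<in> {1..n} \<Longrightarrow> S i \<noteq> {}"
  shows "\<exists>S' J. (\<forall>i\<in>{1..n}. S' i \<subseteq> S i \<and> S' i \<noteq> {}) \<and> finite J \<and> card J \<le> length \<tau>s \<and> v \<notin> J \<and>
    (\<forall>i\<in>{1..n}-J. card (S i) \<le> 2 ^ length \<tau>s * card (S' i)) \<and>
    (\<forall>w\<in>words n S'. \<forall>w'\<in>words n S'. w v = w' v \<longrightarrow>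
       map (\<lambda>\<tau>. a_query n \<Sigma> \<tau> w) \<tau>s = map (\<lambda>\<tau>. a_query n \<Sigma> \<tau> w') \<tau>s)"
  using \<tau>s S
proof (induction \<tau>s arbitrary: S)
  case Nil
  thus ?case by (intro exI[of _ S] exI[of _ "{}"]) auto
next
  case (Cons \<tau> \<tau>s)
  obtain S1 j where S1: "\<And>i. i \<in> {1..n} \<Longrightarrow> S1 i \<subseteq> S i" "\<And>i. i \<in> {1..n} \<Longrightarrow> S1 i \<noteq> {}"
    "j \<noteq> v" "\<And>i. i \<in> {1..n} \<Longrightarrow> i \<noteq> j \<Longrightarrow> card (S i) \<le> 2 * card (S1 i)"
    "\<And>w w'. w \<in> words n S1 \<Longrightarrow> w' \<in> words n S1 \<Longrightarrow> w v = w' v \<Longrightarrow>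
       a_query n \<Sigma> \<tau> w = a_query n \<Sigma> \<tau> w'"
    using a_query_restrict[of n \<Sigma> \<tau> S v, OF fin _ Cons.prems(2,3) v n] Cons.prems(1) by auto
  have "S1 i \<subseteq> \<Sigma> i" if "i \<in> {1..n}" for i using S1(1) Cons.prems(2) that by blast
  with Cons.IH[of S1] Cons.prems(1) S1(2) obtain S' J where
    S': "\<forall>i\<in>{1..n}. S' i \<subseteq> S1 i \<and> S' i \<noteq> {}" and J: "finite J" "card J \<le> length \<tau>s" "v \<notin> J" and
    big: "\<forall>i\<in>{1..n}-J. card (S1 i) \<le> 2 ^ length \<tau>s * card (S' i)" and
    eq: "\<forall>w\<in>words n S'. \<forall>w'\<in>words n S'. w v = w' v \<longrightarrow>
       map (\<lambda>\<tau>. a_query n \<Sigma> \<tau> w) \<tau>s = map (\<lambda>\<tau>. a_query n \<Sigma> \<tau> w') \<tau>s"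
    by auto
  have sub: "words n S' \<subseteq> words n S1" using S' by (intro words_mono) blast
  have same: "map (\<lambda>\<tau>. a_query n \<Sigma> \<tau> w) (\<tau> # \<tau>s) = map (\<lambda>\<tau>. a_query n \<Sigma> \<tau> w') (\<tau> # \<tau>s)"
    if w: "w \<in> words n S'" "w' \<in> words n S'" "w v = w' v" for w w'
  proof -
    have "map (\<lambda>\<tau>. a_query n \<Sigma> \<tau> w) \<tau>s = map (\<lambda>\<tau>. a_query n \<Sigma> \<tau> w') \<tau>s" using eq w by blast
    moreover have "a_query n \<Sigma> \<tau> w = a_query n \<Sigma> \<tau> w'"
      using w sub by (intro S1(5)) auto
    ultimately show ?thesis by simp
  qed
  have big': "card (S i) \<le> 2 ^ length (\<tau> # \<tau>s) * card (S' i)"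
    if "i \<in> {1..n} - insert j J" for i
  proof -
    have "card (S i) \<le> 2 * card (S1 i)" using that by (intro S1(4)) auto
    moreover have "card (S1 i) \<le> 2 ^ length \<tau>s * card (S' i)" using that big by blast
    ultimately show ?thesis by simp
  qed
  show ?case
  proof (intro exI conjI ballI impI)
    show "S' i \<subseteq> S i" "S' i \<noteq> {}" if "i \<in> {1..n}" for i using S' S1(1) that by blast+
    show "finite (insert j J)" "v \<notin> insert j J" using J S1(3) by auto
    show "card (insert j J) \<le> length (\<tau> # \<tau>s)" using J by (simp add: card_insert_if)
  qed (fact big' same)+
qed

text \<open>Once the answers depend on \<open>w v\<close> only, fixing \<open>w v = u\<close> makes
  them constant and prolongs the path to \<open>u\<close>. The bound on \<open>M\<close> leaves more
  letters for \<open>w v\<close> than there are small coordinates, so \<open>u\<close> can avoid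
  these and the next step of the path remains open. Lists shorter than \<open>H\<close> are allowed
  for the sake of leaves.\<close>

lemma box_step:
  fixes S :: "nat \<Rightarrow> nat set" and n :: nat
  defines "\<Sigma> \<equiv> \<lambda>_::nat. {1..n}"
  assumes n: "n \<ge> 2" and v: "v \<in> {1..n}" "v \<notin> F" and F: "finite F"
    and S: "\<And>i. i \<in> {1..n} \<Longrightarrow> S i \<subseteq> {1..n}" "\<And>i. i \<in> {1..n} \<Longrightarrow> S i \<noteq> {}"
    and path: "\<And>w. w \<in> words n S \<Longrightarrow> (w ^^ r) 1 = v"
    and big: "\<And>i. i \<in> {1..n} - F \<Longrightarrow> 2 ^ H * M \<le> card (S i)"
    and M: "card F + H + 1 < M"
    and \<tau>s: "set \<tau>s \<subseteq> assignment_perms n \<Sigma>" "length \<tau>s \<le> H"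
  shows "\<exists>u F' S'. u \<in> {1..n} \<and> u \<notin> F' \<and> finite F' \<and> card F' \<le> card F + H + 1 \<and>
    (\<forall>i\<in>{1..n}. S' i \<subseteq> S i \<and> S' i \<noteq> {}) \<and> (\<forall>w\<in>words n S'. (w ^^ Suc r) 1 = u) \<and>
    (\<forall>i\<in>{1..n}-F'. M \<le> card (S' i)) \<and>
    (\<forall>w\<in>words n S'. \<forall>w'\<in>words n S'.
       map (\<lambda>\<tau>. a_query n \<Sigma> \<tau> w) \<tau>s = map (\<lambda>\<tau>. a_query n \<Sigma> \<tau> w') \<tau>s)"
proof -
  obtain S1 J where
    S1: "\<forall>i\<in>{1..n}. S1 i \<subseteq> S i \<and> S1 i \<noteq> {}" and J: "finite J" "card J \<le> length \<tau>s" "v \<notin> J" and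
    big1: "\<forall>i\<in>{1..n}-J. card (S i) \<le> 2 ^ length \<tau>s * card (S1 i)" and
    eq: "\<forall>w\<in>words n S1. \<forall>w'\<in>words n S1. w v = w' v \<longrightarrow>
       map (\<lambda>\<tau>. a_query n \<Sigma> \<tau> w) \<tau>s = map (\<lambda>\<tau>. a_query n \<Sigma> \<tau> w') \<tau>s"
    using a_queries_restrict[of n \<Sigma> v \<tau>s S] n v(1) \<tau>s(1) S by (auto simp: \<Sigma>_def)
  \<comment> \<open>\<open>v\<close> joins the small coordinates because its letter is about to be
    fixed; this is the extra 1 in the bound on \<open>card F'\<close>.\<close>
  define F' where "F' = insert v (F \<union> J)"
  have finF': "finite F'" using F J by (simp add: F'_def)
  have "card (F \<union> J) \<le> card F + H" using card_Un_le[of F J] J(2) \<tau>s(2) by simp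
  hence cF': "card F' \<le> card F + H + 1" using F J by (simp add: F'_def card_insert_if)
  have M1: "M \<le> card (S1 i)" if "i \<in> {1..n} - (F \<union> J)" for i
  proof -
    have "2 ^ H * M \<le> card (S i)" using big that by blast
    also have "\<dots> \<le> 2 ^ length \<tau>s * card (S1 i)" using big1 that by blast
    also have "\<dots> \<le> 2 ^ H * card (S1 i)" using \<tau>s(2) by simp
    finally show ?thesis by simp
  qed
  have "M \<le> card (S1 v)" using v J by (intro M1) auto
  hence "card F' < card (S1 v)" using cF' M by simp
  hence "\<not> S1 v \<subseteq> F'" using card_mono[OF finF', of "S1 v"] by linarith
  then obtain u where u: "u \<in> S1 v" "u \<notin> F'" by blast
  define S' where "S' = S1(v := {u})"
  have sub1: "words n S' \<subseteq> words n S1" using u by (intro words_mono) (auto simp: S'_def)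
  have sub: "words n S1 \<subseteq> words n S" using S1 by (intro words_mono) auto
  have wv: "w v = u" if "w \<in> words n S'" for w
    using PiE_mem[OF that[unfolded words_def] v(1)] by (simp add: S'_def)
  show ?thesis
  proof (intro exI conjI ballI)
    show "u \<in> {1..n}" using u S1 S(1) v(1) by blast
    show "(w ^^ Suc r) 1 = u" if "w \<in> words n S'" for w
      using path[of w] that sub sub1 wv by auto
    show "M \<le> card (S' i)" if "i \<in> {1..n} - F'" for i
      using M1[of i] that by (auto simp: S'_def F'_def)
    show "S' i \<subseteq> S i" "S' i \<noteq> {}" if "i \<in> {1..n}" for i
      using S1 u that by (auto simp: S'_def)
    show "map (\<lambda>\<tau>. a_query n \<Sigma> \<tau> w) \<tau>s = map (\<lambda>\<tau>. a_query n \<Sigma> \<tau> w') \<tau>s"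
      if "w \<in> words n S'" "w' \<in> words n S'" for w w'
      using eq sub1 wv that by (metis subsetD)
  qed (use u finF' cF' in auto)
qed

section \<open>The adversary against a whole tree\<close>

text \<open>Induction on the depth still available. A round costs a factor of at most
  \<open>2 ^ H\<close> in the box sizes, hence the exponent \<open>H * d\<close>, and adds at most
  \<open>H + 1\<close> small coordinates, hence \<open>(H + 1) * d\<close>; \<open>N\<close> stays
  fixed. The final 2 leaves two letters at \<open>v\<close> when no depth is left, where the output
  is constant.\<close>

lemma depth_lt_rank_confuses:
  fixes S :: "nat \<Rightarrow> nat set" and n :: nat
  defines "\<Sigma> \<equiv> \<lambda>_::nat. {1..n}"
  assumes "decision_tree (words n \<Sigma>) (degree_a_queries H n \<Sigma>) Out T" "dtree_depth T \<le> d"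
    and n: "n \<ge> 2" and "v \<in> {1..n}" "v \<notin> F" "finite F"
    and "\<And>i. i \<in> {1..n} \<Longrightarrow> S i \<subseteq> {1..n}" "\<And>i. i \<in> {1..n} \<Longrightarrow> S i \<noteq> {}"
    and "\<And>w. w \<in> words n S \<Longrightarrow> (w ^^ r) 1 = v"
    and "\<And>i. i \<in> {1..n} - F \<Longrightarrow> 2 ^ (H * d) * N \<le> card (S i)"
    and "card F + (H + 1) * d + 2 \<le> N"
  shows "\<exists>w\<in>words n S. \<exists>w'\<in>words n S. dtree_output T w = dtree_output T w' \<and>
    (w ^^ (r + d + 1)) 1 \<noteq> (w' ^^ (r + d + 1)) 1"
  using assms(2-)
proof (induction d arbitrary: T v F S r)
  case 0
  have "\<exists>y. T = Leaf y" using 0(2) by (cases T) auto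
  then obtain y where T: "T = Leaf y" by blast
  have "2 \<le> card (S v)" using 0(10)[of v] 0(4,5,11) by simp
  then obtain a b where ab: "a \<in> S v" "b \<in> S v" "a \<noteq> b"
    by (meson card_2_iff' obtain_subset_with_card_n subset_iff)
  obtain w where w: "w \<in> words n S" using 0(8) by (fastforce simp: words_def PiE_eq_empty_iff)
  have upd: "w(v := x) \<in> words n S" if "x \<in> S v" for x
    using w that 0(4) by (auto simp: words_def PiE_iff extensional_def)
  \<comment> \<open>The modified word still lies in the box, so its first \<open>r\<close> steps
    again end at \<open>v\<close>.\<close>
  have "((w(v := x)) ^^ (r + 0 + 1)) 1 = x" if "x \<in> S v" for x
  proof -
    have "((w(v := x)) ^^ (r + 0 + 1)) 1 = (w(v := x)) (((w(v := x)) ^^ r) 1)" by simp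
    also have "\<dots> = x" by (subst 0(9)[OF upd[OF that]]) simp
    finally show ?thesis .
  qed
  hence "((w(v := a)) ^^ (r + 0 + 1)) 1 \<noteq> ((w(v := b)) ^^ (r + 0 + 1)) 1" using ab by metis
  moreover have "dtree_output T (w(v := a)) = dtree_output T (w(v := b))" using T by simp
  ultimately show ?case using upd ab(1,2) by blast
next
  case (Suc d)
  let ?X = "words n \<Sigma>" and ?Q = "degree_a_queries H n \<Sigma>"
  define const where "const = (\<lambda>\<tau>s S'. \<forall>w\<in>words n S'. \<forall>w'\<in>words n S'.
    map (\<lambda>\<tau>. a_query n \<Sigma> \<tau> w) \<tau>s = map (\<lambda>\<tau>. a_query n \<Sigma> \<tau> w') \<tau>s)"
  define reduces where "reduces = (\<lambda>S'. \<exists>U. decision_tree ?X ?Q Out U \<and> dtree_depth U \<le> d \<and>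
    (\<forall>w\<in>words n S'. dtree_output T w = dtree_output U w))"
  \<comment> \<open>The heads are chosen before the box \<open>S'\<close>. A leaf reached early
    counts as a query without heads, so both cases go through the same box step.\<close>
  have "\<exists>\<tau>s. set \<tau>s \<subseteq> assignment_perms n \<Sigma> \<and> length \<tau>s \<le> H \<and>
     (\<forall>S'. const \<tau>s S' \<longrightarrow> words n S' \<noteq> {} \<longrightarrow> words n S' \<subseteq> ?X \<longrightarrow> reduces S')"
  proof (cases T)
    case (Leaf y)
    hence "reduces S'" for S'
      using Suc.prems(1) unfolding reduces_def by (intro exI[of _ T]) simp
    thus ?thesis by (intro exI[of _ "[]"]) simp
  next
    case (Node q m)
    with Suc.prems(1) have q: "q \<in> ?Q" "fmdom' m = q ` ?X"
      "\<And>a U. fmlookup m a = Some U \<Longrightarrow> decision_tree ?X ?Q Out U"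
      by (auto elim: decision_tree.cases)
    then obtain \<tau>s where \<tau>s: "length \<tau>s = H" "set \<tau>s \<subseteq> assignment_perms n \<Sigma>"
      "q = (\<lambda>w. map (\<lambda>\<tau>. a_query n \<Sigma> \<tau> w) \<tau>s)" by (auto simp: degree_a_queries_def)
    have "reduces S'"
      if const: "const \<tau>s S'"
        and ne: "words n S' \<noteq> {}" "words n S' \<subseteq> ?X" for S'
    proof -
      \<comment> \<open>The query is constant on the new box, so any word of it selects the subtree
        to descend into.\<close>
      obtain w0 where w0: "w0 \<in> words n S'" using ne by blast
      hence "q w0 \<in> fmdom' m" using ne q(2) by blast
      then obtain U where U: "fmlookup m (q w0) = Some U" by (auto simp: fmlookup_dom'_iff)
      have "dtree_depth U \<in> fmran' (fmmap dtree_depth m)"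
        using U by (auto simp: fmlookup_ran'_iff intro!: exI[of _ "q w0"])
      hence "dtree_depth U \<le> Max (fmran' (fmmap dtree_depth m))"
        by (intro Max_ge) (auto simp: fmran'_alt_def)
      hence "dtree_depth U \<le> d" using Suc.prems(2) Node by simp
      moreover have "dtree_output T w = dtree_output U w" if "w \<in> words n S'" for w
      proof -
        have "q w = q w0" using const that w0 unfolding const_def \<tau>s(3) by blast
        thus ?thesis using U Node by simp
      qed
      ultimately show ?thesis using q(3)[OF U] unfolding reduces_def by blast
    qed
    thus ?thesis using \<tau>s(1,2) by blast
  qed
  then obtain \<tau>s where \<tau>s: "set \<tau>s \<subseteq> assignment_perms n \<Sigma>" "length \<tau>s \<le> H" and
    descend: "\<And>S'. const \<tau>s S' \<Longrightarrow> words n S' \<noteq> {} \<Longrightarrow> words n S' \<subseteq> ?X \<Longrightarrow> reduces S'"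
    by blast
  \<comment> \<open>\<open>box_step\<close> is used with \<open>M = 2 ^ (H * d) * N\<close>, the
    size that the induction hypothesis demands.\<close>
  have "card F + H + 1 < N" using Suc.prems(11) by simp
  also have "N \<le> 2 ^ (H * d) * N" by simp
  finally have M: "card F + H + 1 < 2 ^ (H * d) * N" .
  have big: "2 ^ H * (2 ^ (H * d) * N) \<le> card (S i)" if "i \<in> {1..n} - F" for i
    using Suc.prems(10)[OF that] by (simp add: power_add mult_ac)
  have "\<exists>u F' S'. u \<in> {1..n} \<and> u \<notin> F' \<and> finite F' \<and> card F' \<le> card F + H + 1 \<and>
    (\<forall>i\<in>{1..n}. S' i \<subseteq> S i \<and> S' i \<noteq> {}) \<and> (\<forall>w\<in>words n S'. (w ^^ Suc r) 1 = u) \<and>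
    (\<forall>i\<in>{1..n}-F'. 2 ^ (H * d) * N \<le> card (S' i)) \<and> const \<tau>s S'"
    unfolding const_def \<Sigma>_def
    by (rule box_step[OF Suc.prems(3-9) big M \<tau>s[unfolded \<Sigma>_def]])
  then obtain u F' S' where u: "u \<in> {1..n}" "u \<notin> F'" "finite F'"
    and cF': "card F' \<le> card F + H + 1"
    and S'_sub: "\<forall>i\<in>{1..n}. S' i \<subseteq> S i \<and> S' i \<noteq> {}"
    and path': "\<forall>w\<in>words n S'. (w ^^ Suc r) 1 = u"
    and big': "\<forall>i\<in>{1..n}-F'. 2 ^ (H * d) * N \<le> card (S' i)"
    and const: "const \<tau>s S'"
    by blast
  note S' = bspec[OF S'_sub, THEN conjunct1] bspec[OF S'_sub, THEN conjunct2]
  have S'n: "S' i \<subseteq> {1..n}" if "i \<in> {1..n}" for i using S'(1) Suc.prems(7) that by blast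
  have "words n S' \<noteq> {}" using S'(2) by (fastforce simp: words_def PiE_eq_empty_iff)
  moreover have "words n S' \<subseteq> ?X" using S'n by (intro words_mono) (simp add: \<Sigma>_def)
  ultimately obtain U where U: "decision_tree ?X ?Q Out U" "dtree_depth U \<le> d"
    "\<And>w. w \<in> words n S' \<Longrightarrow> dtree_output T w = dtree_output U w"
    using descend[OF const] unfolding reduces_def by blast
  have "card F' + (H + 1) * d + 2 \<le> N" using cF' Suc.prems(11) by simp
  from Suc.IH[where S = S', OF U(1,2) n u S'n S'(2) bspec[OF path'] bspec[OF big'] this]
  obtain w w' where w: "w \<in> words n S'" "w' \<in> words n S'" "dtree_output U w = dtree_output U w'"
    "(w ^^ (Suc r + d + 1)) 1 \<noteq> (w' ^^ (Suc r + d + 1)) 1" by blast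
  moreover have "words n S' \<subseteq> words n S" using S'(1) by (rule words_mono)
  ultimately show ?case using U(3)
    by (intro bexI[of _ w] bexI[of _ w']) auto
qed

section \<open>Both bounds together for large \<open>n\<close>\<close>

theorem corollary3:
  fixes H t :: nat
  assumes "H > 0" and "t > 0"
  shows "finite {n::nat. n > 0 \<and>
           head_rank H n (\<lambda>_. {1..n}) {1..n} (iter_comp t n) \<noteq> t}"
proof -
  \<comment> \<open>The least values that meet the size hypotheses of the adversary for
    \<open>d = t - 1\<close>, starting from the full box with no small coordinate.\<close>
  define N where "N = (H + 1) * (t - 1) + 2"
  define n0 where "n0 = 2 ^ (H * (t - 1)) * N"
  have "head_rank H n (\<lambda>_. {1..n}) {1..n} (iter_comp t n) = t" if n: "n \<ge> n0" for n
  proof -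
    let ?\<Sigma> = "\<lambda>_::nat. {1..n}"
    let ?tree = "decision_tree (words n ?\<Sigma>) (degree_a_queries H n ?\<Sigma>) {1..n}"
    have "N \<le> n0" by (simp add: n0_def)
    hence n2: "n \<ge> 2" using n by (simp add: N_def)
    obtain T where "?tree T" "dtree_depth T = t" "\<forall>w\<in>words n ?\<Sigma>. dtree_output T w = (w ^^ t) 1"
      using ex_tree_iterating[of H 1 n t] assms(1) n2 by auto
    hence upper: "\<exists>T. ?tree T \<and> computes (words n ?\<Sigma>) T (iter_comp t n) \<and> dtree_depth T = t"
      by (intro exI[of _ T]) (auto simp: computes_def iter_comp_def)
    have lower: "t \<le> dtree_depth T"
      if T: "?tree T" "computes (words n ?\<Sigma>) T (iter_comp t n)" for T
    proof (rule ccontr)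
      assume "\<not> t \<le> dtree_depth T"
      hence "dtree_depth T \<le> t - 1" by simp
      \<comment> \<open>The path starts at 1 with \<open>r = 0\<close>, so the two words disagree on
        iterate \<open>0 + (t - 1) + 1\<close>, which is \<open>t\<close> by
        \<open>t > 0\<close>.\<close>
      from depth_lt_rank_confuses[OF T(1) this n2, where v = 1 and F = "{}" and S = ?\<Sigma> and r = 0 and N = N]
      have "\<exists>w\<in>words n ?\<Sigma>. \<exists>w'\<in>words n ?\<Sigma>. dtree_output T w = dtree_output T w' \<and>
          (w ^^ t) 1 \<noteq> (w' ^^ t) 1"
        using n2 n assms(2) by (simp add: N_def n0_def)
      thus False using T(2) by (auto simp: computes_def iter_comp_def)
    qed
    show ?thesis unfolding head_rank_def
      using upper lower by (intro Least_equality) auto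
  qed
  hence "{n. n > 0 \<and> head_rank H n (\<lambda>_. {1..n}) {1..n} (iter_comp t n) \<noteq> t} \<subseteq> {..<n0}"
    using not_le by blast
  thus ?thesis by (rule finite_subset) simp
qed

end
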